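(* Let $G$ be a connected split graph that is not isomorphic to the star $S_n$ for any $n \geq 2$. Then $G$ is unbalanced split if and only if there is an edge $e \in E(G)$ such that $\omega(G/e) = \omega(G)-1$ and $G/e$ is unbalanced split.
   Context: A $KS$-partition of $G$ is a partition of $V(G)$ into a clique $K$ and an independent set $S$; $G$ is split if it has one. $\omega(G)$ is the clique number and $\alpha(G)$ the independence number. A split graph $G$ is balanced split if it has a $KS$-partition with $|K|=\omega(G)$ and $|S|=\alpha(G)$, and unbalanced split otherwise. The star $S_n$ is $K_1 \vee E_n$ (one vertex joined to $n$ pairwise nonadjacent vertices). For an edge $e=uv$, the graph $G/e$ is obtained from $G$ by adding an edge between $u$ and every neighbour of $v$, then deleting $v$, removing loops and replacing multiple edges by single edges.
   Formalization: The one-vertex graph K_1 is additionally excluded: it is a connected split graph, not a star S_n with n ≥ 2, and is unbalanced split, but it has no edge to contract, so the claim as stated fails for it. *)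

theory Defs
  imports "Graph_Theory.Graph_Theory"
begin

text \<open>
  Finite simple graphs are the \<open>pair_graph\<close>s of the entry Graph_Theory: an undirected edge
  \<open>uv\<close> is represented by the two arcs \<open>(u, v)\<close> and \<open>(v, u)\<close>.
\<close>

definition clique :: "'a pair_pre_digraph \<Rightarrow> 'a set \<Rightarrow> bool" where
  "clique G K \<longleftrightarrow> K \<subseteq> pverts G \<and> (\<forall>u\<in>K. \<forall>v\<in>K. u \<noteq> v \<longrightarrow> (u, v) \<in> parcs G)"

definition independent_set :: "'a pair_pre_digraph \<Rightarrow> 'a set \<Rightarrow> bool" where
  "independent_set G S \<longleftrightarrow> S \<subseteq> pverts G \<and> (\<forall>u\<in>S. \<forall>v\<in>S. (u, v) \<notin> parcs G)"

definition clique_number :: "'a pair_pre_digraph \<Rightarrow> nat" where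
  "clique_number G = Max {card K | K. clique G K}"

definition independence_number :: "'a pair_pre_digraph \<Rightarrow> nat" where
  "independence_number G = Max {card S | S. independent_set G S}"

text \<open>Either part of a \<open>KS\<close>-partition may be empty.\<close>

definition KS_partition :: "'a pair_pre_digraph \<Rightarrow> 'a set \<Rightarrow> 'a set \<Rightarrow> bool" where
  "KS_partition G K S \<longleftrightarrow>
     K \<union> S = pverts G \<and> K \<inter> S = {} \<and> clique G K \<and> independent_set G S"

definition split_graph :: "'a pair_pre_digraph \<Rightarrow> bool" where
  "split_graph G \<longleftrightarrow> (\<exists>K S. KS_partition G K S)"

definition balanced_split :: "'a pair_pre_digraph \<Rightarrow> bool" where
  "balanced_split G \<longleftrightarrow>
     (\<exists>K S. KS_partition G K S \<and> card K = clique_number G \<and> card S = independence_number G)"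

definition unbalanced_split :: "'a pair_pre_digraph \<Rightarrow> bool" where
  "unbalanced_split G \<longleftrightarrow> split_graph G \<and> \<not> balanced_split G"

text \<open>The centre is the vertex 0; the leaves are \<open>1, \<dots>, n\<close>.\<close>

definition star :: "nat \<Rightarrow> nat pair_pre_digraph" where
  "star n = \<lparr> pverts = {0..n}, parcs = {0} \<times> {1..n} \<union> {1..n} \<times> {0} \<rparr>"

text \<open>
  \<open>contract_edge G (u, v)\<close> is \<open>G/uv\<close> with the merged vertex named \<open>u\<close>; contracting the
  reversed arc \<open>(v, u)\<close> gives an isomorphic graph. Parallel edges do not arise since \<open>parcs\<close>
  is a set.
\<close>

fun contract_edge :: "'a pair_pre_digraph \<Rightarrow> 'a \<times> 'a \<Rightarrow> 'a pair_pre_digraph" where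
  "contract_edge G (u, v) =
     (let N = {w. (v, w) \<in> parcs G}; W = pverts G - {v}
      in \<lparr> pverts = W, parcs = (parcs G \<union> {u} \<times> N \<union> N \<times> {u}) \<inter> W \<times> W - Id \<rparr>)"

lemma pair_graph_star: "pair_graph (star n)"
  by unfold_locales (auto simp: star_def symmetric_def sym_def)

lemma pair_graph_contract_edge:
  assumes "pair_graph G"
  shows "pair_graph (contract_edge G e)"
proof -
  interpret pair_graph G by fact
  obtain u v where [simp]: "e = (u, v)" by (cases e)
  show ?thesis
    by unfold_locales
      (auto simp: Let_def symmetric_def sym_def intro: arcs_symmetric)
qed

text \<open>
  The one-vertex graph is unbalanced split but has no edge to contract, so a characterisation of
  unbalanced split graphs by edge contractions has to exclude it.
\<close>

lemma one_vertex_unbalanced_split: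
  assumes "pair_graph G" "card (pverts G) = 1"
  shows "unbalanced_split G" and "parcs G = {}"
proof -
  interpret pair_graph G by fact
  obtain x where x: "pverts G = {x}" using assms(2) by (auto simp: card_1_singleton_iff)
  show e: "parcs G = {}" using in_arcsD1 in_arcsD2 no_loops' x by fastforce
  have sub: "K \<subseteq> {x} \<longleftrightarrow> K = {} \<or> K = {x}" for K by auto
  have "{card K | K. clique G K} = {0, 1}" "{card S | S. independent_set G S} = {0, 1}"
    unfolding clique_def independent_set_def x e sub by force+
  then have "clique_number G = 1" "independence_number G = 1"
    by (simp_all add: clique_number_def independence_number_def)
  moreover have "KS_partition G {x} {}"
    by (simp add: KS_partition_def clique_def independent_set_def x)
  moreover have "card K + card S = 1" if "KS_partition G K S" for K S
    using that card_Un_disjoint[of K S] x by (auto simp: KS_partition_def) (metis One_nat_def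
        card_Un_disjoint card.empty card_insert_disjoint empty_iff finite.emptyI finite_Un finite_insert)
  ultimately show "unbalanced_split G"
    unfolding unbalanced_split_def split_graph_def balanced_split_def by fastforce
qed

end

theory Submission
  imports Defs
begin

text \<open>
  A clique and an independent set share at most one vertex, so \<open>\<omega> + \<alpha> \<le> |V| + 1\<close> in every graph,
  and a split graph is unbalanced iff equality holds. Contracting an edge removes one vertex and
  never increases \<open>\<alpha>\<close>; hence if \<open>\<omega>\<close> drops by one and \<open>G/e\<close> attains equality, so does \<open>G\<close>.
  Conversely, let \<open>G\<close> attain equality, with a maximum clique \<open>K\<close> and a maximum independent set \<open>I\<close>
  meeting in \<open>w\<close>. Contracting an edge of \<open>K - {w}\<close> preserves equality. If there is no such edge, \<open>G\<close>
  is a star whose centre is the vertex of \<open>K - {w}\<close>, and \<open>K\<^sub>2\<close> is the only case left.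
\<close>

context pair_graph
begin

section \<open>Maximum cliques and maximum independent sets\<close>

lemma finite_card_cliques: "finite {card K | K. clique G K}"
proof -
  have "{card K | K. clique G K} \<subseteq> card ` Pow (pverts G)"
    by (auto simp: clique_def)
  then show ?thesis
    using pair_finite_verts by (meson finite_Pow_iff finite_imageI finite_subset)
qed

lemma finite_card_independent_sets: "finite {card S | S. independent_set G S}"
proof -
  have "{card S | S. independent_set G S} \<subseteq> card ` Pow (pverts G)"
    by (auto simp: independent_set_def)
  then show ?thesis
    using pair_finite_verts by (meson finite_Pow_iff finite_imageI finite_subset)
qed

lemma card_le_clique_number: "clique G K \<Longrightarrow> card K \<le> clique_number G"
  unfolding clique_number_def using finite_card_cliques by (auto intro: Max_ge)

lemma card_le_independence_number: "independent_set G S \<Longrightarrow> card S \<le> independence_number G"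
  unfolding independence_number_def using finite_card_independent_sets by (auto intro: Max_ge)

lemma maximum_clique:
  obtains K where "clique G K" "card K = clique_number G"
proof -
  have "clique G {}" by (simp add: clique_def)
  then have "clique_number G \<in> {card K | K. clique G K}"
    unfolding clique_number_def using finite_card_cliques by (intro Max_in) auto
  then show ?thesis using that by auto
qed

lemma maximum_independent_set:
  obtains S where "independent_set G S" "card S = independence_number G"
proof -
  have "independent_set G {}" by (simp add: independent_set_def)
  then have "independence_number G \<in> {card S | S. independent_set G S}"
    unfolding independence_number_def using finite_card_independent_sets by (intro Max_in) auto
  then show ?thesis using that by auto
qed

lemma clique_Int_independent_set:
  assumes "clique G K" "independent_set G S"
  shows "K \<inter> S = {} \<or> (\<exists>w. K \<inter> S = {w})"
  using assms unfolding clique_def independent_set_def by blast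

lemma card_Un_clique_independent_set:
  assumes "clique G K" "independent_set G S"
  shows "card (K \<union> S) + card (K \<inter> S) = card K + card S"
    and "card (K \<union> S) \<le> card (pverts G)" and "card (K \<inter> S) \<le> 1"
proof -
  have sub: "K \<subseteq> pverts G" "S \<subseteq> pverts G"
    using assms by (auto simp: clique_def independent_set_def)
  then have "finite K" "finite S" using pair_finite_verts by (auto intro: finite_subset)
  then show "card (K \<union> S) + card (K \<inter> S) = card K + card S" by (metis card_Un_Int)
  show "card (K \<union> S) \<le> card (pverts G)" using sub pair_finite_verts by (simp add: card_mono)
  show "card (K \<inter> S) \<le> 1" using clique_Int_independent_set[OF assms] by auto
qed

lemma clique_number_add_independence_number_le:
  "clique_number G + independence_number G \<le> card (pverts G) + 1"
proof -
  obtain K where K: "clique G K" "card K = clique_number G" by (rule maximum_clique)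
  obtain S where S: "independent_set G S" "card S = independence_number G"
    by (rule maximum_independent_set)
  show ?thesis using card_Un_clique_independent_set[OF K(1) S(1)] K S by linarith
qed

lemma KS_partition_card:
  assumes "KS_partition G K S"
  shows "card K + card S = card (pverts G)"
    and "card K \<le> clique_number G" and "card S \<le> independence_number G"
proof -
  have KS: "K \<union> S = pverts G" "K \<inter> S = {}" "clique G K" "independent_set G S"
    using assms by (auto simp: KS_partition_def)
  show "card K + card S = card (pverts G)"
    using card_Un_clique_independent_set(1)[OF KS(3,4)] by (simp add: KS)
  show "card K \<le> clique_number G" "card S \<le> independence_number G"
    using card_le_clique_number card_le_independence_number KS by blast+
qed

text \<open>The parts of a KS-partition have sizes at most \<omega> and \<alpha> that add up to |V|.
  If both bounds are attained, then \<omega> + \<alpha> = |V|; otherwise the sum exceeds |V|, and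
  the general upper bound fixes it at |V| + 1.\<close>

lemma unbalanced_split_iff:
  "unbalanced_split G \<longleftrightarrow>
    split_graph G \<and> clique_number G + independence_number G = card (pverts G) + 1"
proof (cases "split_graph G")
  case True
  then obtain K S where KS: "KS_partition G K S" by (auto simp: split_graph_def)
  show ?thesis
  proof (cases "balanced_split G")
    case True
    then have "clique_number G + independence_number G = card (pverts G)"
      using KS_partition_card(1) by (metis balanced_split_def)
    with True show ?thesis by (simp add: unbalanced_split_def)
  next
    case False
    then have "card K \<noteq> clique_number G \<or> card S \<noteq> independence_number G"
      using KS by (auto simp: balanced_split_def)
    then show ?thesis
      using KS_partition_card[OF KS] clique_number_add_independence_number_le True False
      by (auto simp: unbalanced_split_def)
  qed
qed (simp add: unbalanced_split_def)

section \<open>Effect of a contraction on cliques and independent sets\<close>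

lemma pair_graph_contraction: "pair_graph (contract_edge G e)"
  by (rule pair_graph_contract_edge) unfold_locales

lemma pverts_contract_edge: "pverts (contract_edge G (u, v)) = pverts G - {v}"
  by (simp add: Let_def)

lemma card_pverts_contract_edge:
  assumes "(u, v) \<in> parcs G"
  shows "card (pverts (contract_edge G (u, v))) + 1 = card (pverts G)"
  unfolding pverts_contract_edge
  using in_arcsD2[OF assms] pair_finite_verts
  by (metis Suc_eq_plus1 card_Suc_Diff1)

text \<open>Contraction only adds adjacencies between the remaining vertices, and \<open>G\<close>
  has no loops that it could discard.\<close>

lemma independent_set_of_contract_edge:
  assumes "independent_set (contract_edge G e) S"
  shows "independent_set G S"
proof -
  obtain u v where e: "e = (u, v)" by (cases e)
  show ?thesis
    using assms unfolding e independent_set_def pverts_contract_edge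
    by (auto simp: Let_def dest: no_loops')
qed

lemma independence_number_contract_edge_le:
  "independence_number (contract_edge G e) \<le> independence_number G"
proof -
  interpret C: pair_graph "contract_edge G e" by (rule pair_graph_contraction)
  obtain S where "independent_set (contract_edge G e) S"
    "card S = independence_number (contract_edge G e)"
    by (rule C.maximum_independent_set)
  then show ?thesis
    using independent_set_of_contract_edge card_le_independence_number by metis
qed

lemma clique_contract_edge:
  assumes "clique G K"
  shows "clique (contract_edge G (u, v)) (K - {v})"
  using assms by (auto simp: clique_def Let_def)

text \<open>Every new arc has \<open>u\<close> as an endpoint, and \<open>v\<close> is the only
  vertex lost.\<close>

lemma independent_set_contract_edge:
  assumes "independent_set G S" "u \<notin> S" "v \<notin> S"
  shows "independent_set (contract_edge G (u, v)) S"
  using assms by (auto simp: independent_set_def Let_def)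

lemma unbalanced_split_of_contract_edge:
  assumes "split_graph G" "e \<in> parcs G"
    and "clique_number (contract_edge G e) = clique_number G - 1"
    and "unbalanced_split (contract_edge G e)"
  shows "unbalanced_split G"
proof -
  obtain u v where e: "e = (u, v)" by (cases e)
  interpret C: pair_graph "contract_edge G e" by (rule pair_graph_contraction)
  \<comment> \<open>The edge forces \<omega> \<ge> 2, so the subtraction in
    \<open>clique_number G - 1\<close> is not truncated.\<close>
  have "(v, u) \<in> parcs G" using assms(2) by (simp add: e arcs_symmetric)
  then have "clique G {u, v}" "u \<noteq> v"
    using assms(2) in_arcsD1 in_arcsD2 no_loops' by (auto simp: clique_def e)
  then have "clique_number G \<ge> 2" using card_le_clique_number by fastforce
  moreover have "clique_number (contract_edge G e) + independence_number (contract_edge G e)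
      = card (pverts (contract_edge G e)) + 1"
    using assms(4) C.unbalanced_split_iff by simp
  ultimately show ?thesis
    using assms(1,3) card_pverts_contract_edge[of u v] assms(2)
      independence_number_contract_edge_le[of e] clique_number_add_independence_number_le
    unfolding unbalanced_split_iff e by linarith
qed

text \<open>In the contraction, \<open>K - {v}\<close> and \<open>I\<close> have sizes \<omega> - 1
  and \<alpha>, which already exhaust the upper bound |V| for the sum of the two new numbers; so
  both sets are maximum there. Independence of \<open>I\<close> is assumed in the contraction so
  that \<open>I\<close> may contain an endpoint of the edge, as happens for
  \<open>K\<^sub>2\<close>.\<close>

lemma contract_edge_unbalanced_split:
  assumes K: "clique G K" "card K = clique_number G"
    and I: "card I = independence_number G"
    and tight: "clique_number G + independence_number G = card (pverts G) + 1"
    and uv: "u \<in> K" "v \<in> K" "u \<noteq> v"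
    and I': "independent_set (contract_edge G (u, v)) I"
  shows "clique_number (contract_edge G (u, v)) = clique_number G - 1"
    and "unbalanced_split (contract_edge G (u, v))"
proof -
  let ?H = "contract_edge G (u, v)"
  interpret C: pair_graph ?H by (rule pair_graph_contraction)
  have fin: "finite K" using K(1) pair_finite_verts by (auto simp: clique_def intro: finite_subset)
  have cv: "card (pverts ?H) + 1 = card (pverts G)"
    using K(1) uv by (intro card_pverts_contract_edge) (auto simp: clique_def)
  have K': "clique ?H (K - {v})" by (rule clique_contract_edge[OF K(1)])
  have cK: "card (K - {v}) + 1 = card K" using uv(2) fin by (metis Suc_eq_plus1 card_Suc_Diff1)
  note le = C.card_le_clique_number[OF K'] C.card_le_independence_number[OF I']
    C.clique_number_add_independence_number_le
  show "clique_number ?H = clique_number G - 1"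
    using le cv cK K(2) I tight by linarith
  have eq: "clique_number ?H + independence_number ?H = card (pverts ?H) + 1"
    using le cv cK K(2) I tight by linarith
  \<comment> \<open>The two sets share at most one vertex, so by their sizes they cover the
    contraction. Leaving a shared vertex to the clique gives a KS-partition.\<close>
  note un = C.card_Un_clique_independent_set[OF K' I']
  have "card ((K - {v}) \<union> I) = card (pverts ?H)"
    using un cv cK K(2) I tight by linarith
  moreover have "(K - {v}) \<union> I \<subseteq> pverts ?H"
    using K' I' by (auto simp: clique_def independent_set_def)
  ultimately have "(K - {v}) \<union> I = pverts ?H"
    using C.pair_finite_verts by (simp add: card_subset_eq)
  then have "KS_partition ?H (K - {v}) (I - (K - {v}))"
    using K' I' by (auto simp: KS_partition_def independent_set_def)
  then show "unbalanced_split ?H"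
    using eq C.unbalanced_split_iff by (auto simp: split_graph_def)
qed

section \<open>Neighbours in connected graphs, and recognising stars\<close>

lemma connected_ex_arc:
  assumes "connected (with_proj G)" "s \<in> pverts G" "card (pverts G) \<noteq> 1"
  obtains t where "(s, t) \<in> parcs G"
proof -
  have "strongly_connected (with_proj G)"
    using assms(1) pair_sym_arcs symmetric_connected_imp_strongly_connected by blast
  moreover obtain t where t: "t \<in> pverts G" "t \<noteq> s"
    using assms(2,3) by (metis is_singletonI' is_singleton_altdef empty_iff)
  ultimately have "s \<rightarrow>\<^sup>*\<^bsub>with_proj G\<^esub> t"
    using assms(2) by (auto simp: strongly_connected_def)
  then show ?thesis
    using t(2) that by (cases rule: converse_reachable_cases) auto
qed

text \<open>An arc is the pair of its endpoints, so the vertex map determines the arc map and passes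
  its injectivity on.\<close>

lemma digraph_isoI:
  assumes "inj_on f (pverts G)"
    and "pverts H = f ` pverts G" and "parcs H = map_prod f f ` parcs G"
  shows "digraph_iso (with_proj G) (with_proj H)"
proof -
  let ?h = "\<lparr> iso_verts = f, iso_arcs = map_prod f f, iso_head = snd, iso_tail = fst \<rparr>"
  have "inj_on (map_prod f f) (pverts G \<times> pverts G)"
    using assms(1) by (simp add: map_prod_inj_on)
  moreover have "parcs G \<subseteq> pverts G \<times> pverts G"
    using in_arcsD1 in_arcsD2 by auto
  ultimately have "inj_on (map_prod f f) (parcs G)" by (rule inj_on_subset)
  then have "pre_digraph.digraph_isomorphism (with_proj G) ?h"
    using assms(1) wf_digraph_axioms by (auto simp: pre_digraph.digraph_isomorphism_def)
  moreover have "with_proj H = app_iso ?h (with_proj G)"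
    using assms(2,3) by (simp add: app_iso_def with_proj_def)
  ultimately show ?thesis by (auto simp: digraph_iso_def)
qed

lemma digraph_iso_star:
  assumes V: "pverts G = insert x L" and x: "x \<notin> L" and E: "parcs G = {x} \<times> L \<union> L \<times> {x}"
  shows "digraph_iso (with_proj G) (with_proj (star (card L)))"
proof -
  have "finite L" using V pair_finite_verts by simp
  then obtain h where h: "bij_betw h L {1..card L}"
    using finite_same_card_bij by (metis card_atLeastAtMost diff_Suc_1 finite_atLeastAtMost)
  define f where "f = h(x := 0)"
  have fL: "f ` L = {1..card L}" and fx: "f x = 0"
    using h x by (auto simp: f_def bij_betw_def)
  have "inj_on f L" using h x by (auto simp: f_def bij_betw_def inj_on_def)
  then have inj: "inj_on f (pverts G)" using fL fx x by (auto simp: V)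
  have "map_prod f f ` parcs G = {f x} \<times> f ` L \<union> f ` L \<times> {f x}"
    unfolding E image_Un by (simp add: map_prod_surj_on[OF refl refl])
  then show ?thesis
    using fL fx by (intro digraph_isoI[OF inj]) (auto simp: star_def V)
qed

end

section \<open>The equivalence, with the choice of the edge to contract\<close>

theorem theorem4p2:
  fixes G :: "'a pair_pre_digraph"
  assumes "pair_graph G"
    and "connected (with_proj G)"
    and "split_graph G"
    and "\<And>n. n \<ge> 2 \<Longrightarrow> \<not> digraph_iso (with_proj G) (with_proj (star n))"
    and "card (pverts G) \<noteq> 1"
  shows "unbalanced_split G \<longleftrightarrow>
    (\<exists>e\<in>parcs G. clique_number (contract_edge G e) = clique_number G - 1
                \<and> unbalanced_split (contract_edge G e))"
proof
  interpret pair_graph G by fact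
  assume "unbalanced_split G"
  then have tight: "clique_number G + independence_number G = card (pverts G) + 1"
    using unbalanced_split_iff by blast
  obtain K where K: "clique G K" "card K = clique_number G" by (rule maximum_clique)
  obtain I where I: "independent_set G I" "card I = independence_number G"
    by (rule maximum_independent_set)
  note un = card_Un_clique_independent_set[OF K(1) I(1)]
  have sub: "K \<subseteq> pverts G" "I \<subseteq> pverts G"
    using K(1) I(1) by (auto simp: clique_def independent_set_def)
  \<comment> \<open>The intersection has at most one vertex and the union at most |V|, so a total of
    |V| + 1 forces equality in both.\<close>
  have "card (K \<inter> I) = 1" "card (K \<union> I) = card (pverts G)"
    using un K(2) I(2) tight by linarith+
  then obtain w where w: "K \<inter> I = {w}" and V: "K \<union> I = pverts G"
    using sub pair_finite_verts card_subset_eq[of "pverts G" "K \<union> I"]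
    by (auto simp: card_1_singleton_iff)
  have arc: "(u, v) \<in> parcs G" if "u \<in> K" "v \<in> K" "u \<noteq> v" for u v
    using K(1) that by (auto simp: clique_def)
  have "\<exists>u\<in>K. \<exists>v\<in>K. u \<noteq> v \<and> independent_set (contract_edge G (u, v)) I"
  proof (cases "\<exists>u\<in>K - {w}. \<exists>v\<in>K - {w}. u \<noteq> v")
    case True
    then obtain u v where uv: "u \<in> K - {w}" "v \<in> K - {w}" "u \<noteq> v" by blast
    then have "u \<notin> I" "v \<notin> I" using w by auto
    then show ?thesis using uv independent_set_contract_edge[OF I(1)] by blast
  next
    case False
    \<comment> \<open>A neighbour of \<open>s\<close> exists by connectedness; it lies outside
      \<open>I\<close>, hence in \<open>K - {w}\<close>, since \<open>K\<close> and \<open>I\<close>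
      cover the graph.\<close>
    have nb: "\<exists>t\<in>K - {w}. (s, t) \<in> parcs G" if s: "s \<in> I" for s
    proof -
      obtain t where t: "(s, t) \<in> parcs G"
        using connected_ex_arc assms(2,5) s sub by blast
      then have "t \<notin> I" using s I(1) by (auto simp: independent_set_def)
      then show ?thesis using t V w in_arcsD2[OF t] by auto
    qed
    \<comment> \<open>Applied to \<open>w\<close> itself, \<open>nb\<close> shows that
      \<open>K - {w}\<close> is not empty; by the case assumption it is a single vertex.\<close>
    then obtain x where x: "x \<in> K - {w}" using w by blast
    have K': "K = {w, x}" using False x w by blast
    have xI: "x \<notin> I" using x w by auto
    have Ix: "(s, x) \<in> parcs G" if "s \<in> I" for s
      using nb[OF that] K' by auto
    have V': "pverts G = insert x I" using V K' w by auto
    have E: "parcs G = {x} \<times> I \<union> I \<times> {x}"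
    proof (intro equalityI subrelI)
      fix a b assume ab: "(a, b) \<in> parcs G"
      then have "a \<in> insert x I" "b \<in> insert x I" "a \<noteq> b" "\<not> (a \<in> I \<and> b \<in> I)"
        using in_arcsD1 in_arcsD2 no_loops' V' I(1) by (auto simp: independent_set_def)
      then show "(a, b) \<in> {x} \<times> I \<union> I \<times> {x}" by auto
    qed (auto simp: Ix arcs_symmetric)
    \<comment> \<open>\<open>G\<close> is a star with \<open>card I\<close> leaves, so excluding the
      larger stars leaves only \<open>I = {w}\<close>.\<close>
    have "\<not> card I \<ge> 2" using digraph_iso_star[OF V' xI E] assms(4) by blast
    moreover have "finite I" using sub pair_finite_verts by (auto intro: finite_subset)
    moreover have "w \<in> I" using w by auto
    ultimately have "card I = 1" by (cases "card I") auto
    then have "I = {w}" using \<open>w \<in> I\<close> by (auto simp: card_1_singleton_iff)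
    \<comment> \<open>The orientation matters: contracting \<open>(w, x)\<close> keeps the name
      \<open>w\<close>, so \<open>I\<close> survives, and the arc from \<open>w\<close> to itself is
      removed as a loop.\<close>
    then have "independent_set (contract_edge G (w, x)) I"
      using sub x by (auto simp: independent_set_def Let_def)
    moreover have "w \<in> K" "x \<in> K" "w \<noteq> x" using x w by auto
    ultimately show ?thesis by (intro bexI[of _ w] bexI[of _ x] conjI)
  qed
  then obtain u v where uv: "u \<in> K" "v \<in> K" "u \<noteq> v"
    and I': "independent_set (contract_edge G (u, v)) I" by blast
  show "\<exists>e\<in>parcs G. clique_number (contract_edge G e) = clique_number G - 1
                \<and> unbalanced_split (contract_edge G e)"
    using contract_edge_unbalanced_split[OF K I(2) tight uv I'] arc[OF uv] by blast
next
  interpret pair_graph G by fact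
  assume "\<exists>e\<in>parcs G. clique_number (contract_edge G e) = clique_number G - 1
                \<and> unbalanced_split (contract_edge G e)"
  then show "unbalanced_split G"
    using unbalanced_split_of_contract_edge assms(3) by blast
qed

end
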